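(* For every integer $n\ge 0$, the second order Padé approximant ${}_{[1|1]}He_n(x)$ of the ordinary Hermite polynomial satisfies $$ {}_{[1|1]}He_n(x)=\frac{1-\frac14\partial_x^2}{1+\frac14\partial_x^2}\{x^n\}=e_n^{(2)}\!\left(x,-\tfrac14\right)-\frac{n(n-1)}{4}\,e_{n-2}^{(2)}\!\left(x,-\tfrac14\right). $$
   Context: Padé approximants: for a function $f$ with Maclaurin series at $0$, the Padé approximant ${}_{[p|q]}f(s)=\frac{\sum_{j=0}^{p}a_js^j}{\sum_{j=0}^{q}b_js^j}$, normalized by $b_0=1$, is the rational function whose derivatives at $0$ of orders $k=0,1,\dots,p+q$ agree with those of $f$; its order is $p+q$. The ordinary Hermite polynomials $He_n(x)$ are the Appell polynomials with amplitude $A(t)=e^{-t^2/2}$, i.e. $\sum_{n\ge0}\frac{t^n}{n!}He_n(x)=e^{-t^2/2}e^{xt}$. The Padé approximant of the amplitude is ${}_{[p|q]}e^{-t^2/2}:=R(t^2/2)$, where $R(s)={}_{[p|q]}e^{-s}$ is the Padé approximant of $e^{-s}$ in the variable $s$. The Padé approximant of $He_n$ is the polynomial ${}_{[p|q]}He_n(x)$ defined by $\sum_{n\ge0}\frac{t^n}{n!}\,{}_{[p|q]}He_n(x)=R(t^2/2)\,e^{xt}$ or, equivalently, ${}_{[p|q]}He_n(x)=R(\partial_x^2/2)\{x^n\}$. Here $\partial_x=d/dx$, and a rational function of $\partial_x$ that is regular at $0$ acts on polynomials through its Maclaurin series (only finitely many terms contribute). Second order two-variable truncated exponential polynomials: $e_n^{(2)}(x,y)=n!\sum_{r=0}^{\lfloor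 n/2\rfloor}\frac{x^{n-2r}y^r}{(n-2r)!}$ for $n\ge0$. For $n<2$ the term containing $e_{n-2}^{(2)}$ is zero (its coefficient $n(n-1)$ vanishes). *)

theory Defs
  imports "HOL-Analysis.Analysis"
begin

(* The rational function is taken in lowest terms: otherwise a common factor of
   numerator and denominator would, since x / 0 = 0, give different functions
   representing the same rational function. Its domain is all of the reals, but only
   its germ at 0 matters below. *)
definition is_pade :: "nat \<Rightarrow> nat \<Rightarrow> (real \<Rightarrow> real) \<Rightarrow> (real \<Rightarrow> real) \<Rightarrow> bool" where
  "is_pade p q f R \<longleftrightarrow>
     (\<exists>a b :: real poly. degree a \<le> p \<and> degree b \<le> q \<and> coprime a b \<and> coeff b 0 = 1 \<and>
        R = (\<lambda>s. poly a s / poly b s) \<and>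
        (\<forall>k\<le>p + q. (deriv ^^ k) R 0 = (deriv ^^ k) f 0))"

(* Meaningful only if an approximant exists, which is not automatic; the approximant is
   unique if it exists. *)
definition pade :: "nat \<Rightarrow> nat \<Rightarrow> (real \<Rightarrow> real) \<Rightarrow> real \<Rightarrow> real" where
  "pade p q f = (THE R. is_pade p q f R)"

(* The Appell polynomials with amplitude A, for A analytic at 0: the generating function
   (SUM n. t^n / n! * P n x) = A t * exp (x * t), as a power series in t converging
   near 0, for every x. *)
definition appell :: "(real \<Rightarrow> real) \<Rightarrow> nat \<Rightarrow> real poly" where
  "appell A = (THE P. \<forall>x. (\<lambda>t. A t * exp (x * t)) has_fps_expansion
                             Abs_fps (\<lambda>n. poly (P n) x / fact n))"

definition hermite_He :: "nat \<Rightarrow> real poly" where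
  "hermite_He = appell (\<lambda>t. exp (- (t ^ 2 / 2)))"

(* The amplitude exp (- t^2/2) of hermite_He is replaced by R (t^2/2), where R is the
   approximant of exp (- s) in the variable s. *)
definition pade_He :: "nat \<Rightarrow> nat \<Rightarrow> nat \<Rightarrow> real poly" where
  "pade_He p q = appell (\<lambda>t. pade p q (\<lambda>s. exp (- s)) (t ^ 2 / 2))"

(* The action of f(d/dx) on polynomials through the Maclaurin series of f; the terms of
   order exceeding the degree vanish. *)
definition deriv_op :: "(real \<Rightarrow> real) \<Rightarrow> real poly \<Rightarrow> real poly" where
  "deriv_op f P = (\<Sum>k\<le>degree P. smult ((deriv ^^ k) f 0 / fact k) ((pderiv ^^ k) P))"

definition trunc_exp2 :: "nat \<Rightarrow> real \<Rightarrow> real \<Rightarrow> real" where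
  "trunc_exp2 n x y = fact n * (\<Sum>r\<le>n div 2. x ^ (n - 2 * r) * y ^ r / fact (n - 2 * r))"

end

(* Matching the coefficients of 1, s and s^2 in exp (- s) gives the approximant
   R s = (1 - s/2) / (1 + s/2), so that R (t^2/2) is the given rational function of t.
   For an amplitude A with Maclaurin series F, both the n-th Appell polynomial and A (d/dx)
   applied to x^n equal n! times the n-th coefficient of F * exp (x t).
   Since 1 / (1 - y t^2) is a geometric series, the truncated exponential polynomials form
   the Appell sequence of that amplitude. With y = - 1/4, the factor 1 - t^2/4 in the
   numerator produces the difference of two terms, the second one shifted by two indices. *)

theory Submission
  imports Defs
begin

lemma higher_deriv_has_fps_expansion:
  fixes f :: "'a :: {banach, real_normed_field} \<Rightarrow> 'a"
  assumes "f has_fps_expansion F"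
  shows "(deriv ^^ n) f has_fps_expansion (fps_deriv ^^ n) F"
  using assms by (induction n) (auto intro: has_fps_expansion_deriv)

text \<open>Links the iterated derivatives at 0 in \<open>is_pade\<close> and
  \<open>deriv_op\<close> to formal power series, where the computations take place.\<close>

lemma fps_nth_has_fps_expansion:
  fixes f :: "'a :: {banach, real_normed_field} \<Rightarrow> 'a"
  assumes "f has_fps_expansion F"
  shows "fps_nth F n = (deriv ^^ n) f 0 / fact n"
proof -
  have "(deriv ^^ n) f 0 = fps_nth ((fps_deriv ^^ n) F) 0"
    using higher_deriv_has_fps_expansion[OF assms, of n]
    by (auto simp: has_fps_expansion_def eval_fps_at_0 dest: eventually_nhds_x_imp_x)
  then show ?thesis
    by (simp add: fps_0th_higher_deriv)
qed

lemma poly_has_fps_expansion: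
  fixes p :: "'a :: {banach, real_normed_field} poly"
  shows "poly p has_fps_expansion fps_of_poly p"
  by (simp add: has_fps_expansion_def)

lemma poly_quotient_has_fps_expansion:
  fixes a b :: "'a :: {banach, real_normed_field} poly"
  assumes "coeff b 0 \<noteq> 0"
  shows "(\<lambda>s. poly a s / poly b s) has_fps_expansion fps_of_poly a / fps_of_poly b"
  using assms by (intro has_fps_expansion_divide' poly_has_fps_expansion) simp

lemma higher_pderiv_monom_1:
  assumes "k \<le> n"
  shows "(pderiv ^^ k) (monom 1 n) = monom (fact n / fact (n - k) :: 'a :: field_char_0) (n - k)"
  using assms
proof (induction k)
  case (Suc k)
  then have "n - k = Suc (n - Suc k)" by simp
  then have "fact (n - k) = (of_nat (n - k) * fact (n - Suc k) :: 'a)" "n - k \<noteq> 0"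
    by (simp_all only: fact_Suc)
  then show ?case
    using Suc by (simp add: pderiv_monom)
qed simp

text \<open>The k-th derivative of x^n, divided by n!, is the coefficient of t^(n-k) in exp (x t),
  so the operator sum is a Cauchy product.\<close>

lemma deriv_op_monom:
  fixes f :: "real \<Rightarrow> real"
  assumes "f has_fps_expansion F"
  shows "poly (deriv_op f (monom 1 n)) x = fact n * fps_nth (F * fps_exp x) n"
proof -
  have "poly (deriv_op f (monom 1 n)) x
      = (\<Sum>k\<le>n. fps_nth F k * (fact n / fact (n - k) * x ^ (n - k)))"
    unfolding deriv_op_def degree_monom_eq[OF one_neq_zero]
    by (simp add: poly_sum poly_monom higher_pderiv_monom_1 fps_nth_has_fps_expansion[OF assms])
  also have "\<dots> = fact n * fps_nth (F * fps_exp x) n"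
    by (simp add: fps_mult_nth sum_distrib_left atLeast0AtMost field_simps)
  finally show ?thesis .
qed

text \<open>Existence for the description \<open>appell\<close> comes from
  \<open>deriv_op_monom\<close>. For uniqueness, an expansion at 0 determines its coefficients, so
  two candidates agree at every real x and are equal as polynomials.\<close>

lemma appell_eq_deriv_op:
  assumes A: "A has_fps_expansion F"
  shows "appell A n = deriv_op A (monom 1 n)"
proof -
  define P where "P = (\<lambda>n. deriv_op A (monom 1 n))"
  have F_eq: "Abs_fps (\<lambda>n. poly (P n) x / fact n) = F * fps_exp x" for x
    by (rule fps_ext) (simp add: P_def deriv_op_monom[OF A])
  have prod: "(\<lambda>t. A t * exp (x * t)) has_fps_expansion F * fps_exp x" for x
    by (intro has_fps_expansion_mult A has_fps_expansion_exp)
  have "appell A = P"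
    unfolding appell_def
  proof (rule the_equality)
    show "\<forall>x. (\<lambda>t. A t * exp (x * t)) has_fps_expansion Abs_fps (\<lambda>n. poly (P n) x / fact n)"
      by (simp add: F_eq prod)
  next
    fix Q :: "nat \<Rightarrow> real poly"
    assume Q: "\<forall>x. (\<lambda>t. A t * exp (x * t)) has_fps_expansion Abs_fps (\<lambda>n. poly (Q n) x / fact n)"
    have "poly (Q m) x = poly (P m) x" for m x
      using fps_nth_has_fps_expansion[OF Q[rule_format, of x], of m]
        fps_nth_has_fps_expansion[OF prod, of x m] F_eq[of x, symmetric]
      by simp
    then show "Q = P"
      by (auto intro!: ext simp: poly_eq_poly_eq_iff[symmetric])
  qed
  then show ?thesis
    by (simp add: P_def)
qed

text \<open>The equivalence supplies both existence and uniqueness for the description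
  \<open>pade\<close>.\<close>

lemma is_pade_1_1_exp_neg_iff:
  "is_pade 1 1 (\<lambda>s. exp (- s)) R \<longleftrightarrow> R = (\<lambda>s. (1 - s / 2) / (1 + s / 2))"
proof -
  let ?f = "\<lambda>s::real. exp (- s)"
  have f: "(deriv ^^ k) ?f 0 = fact k * fps_nth (fps_exp (- 1)) k" for k
    unfolding fps_nth_has_fps_expansion[OF has_fps_expansion_exp_neg1] by simp
  \<comment> \<open>Matching derivatives fixes both polynomials, which leaves coprimality to be
    checked for a single pair.\<close>
  have agree: "(\<forall>k\<le>1 + 1. (deriv ^^ k) (\<lambda>s. poly a s / poly b s) 0 = (deriv ^^ k) ?f 0)
      \<longleftrightarrow> a = [:1, - (1 / 2):] \<and> b = [:1, 1 / 2:]"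
    if a: "degree a \<le> 1" and b: "degree b \<le> 1" and b0: "coeff b 0 = 1" for a b :: "real poly"
  proof -
    define F where "F = fps_of_poly a / fps_of_poly b"
    have F: "(\<lambda>s. poly a s / poly b s) has_fps_expansion F"
      unfolding F_def using b0 by (intro poly_quotient_has_fps_expansion) simp
    have "F * fps_of_poly b = fps_of_poly a"
      unfolding F_def using b0 by (simp add: fps_divide_unit mult.assoc inverse_mult_eq_1)
    then have nth: "fps_nth (F * fps_of_poly b) k = coeff a k" for k
      by simp
    \<comment> \<open>Coefficients 0, 1, 2 of F * b = a; the degree bounds make the quadratic
      coefficients of a and b vanish.\<close>
    have sys: "fps_nth F 0 = coeff a 0" "fps_nth F 0 * coeff b 1 + fps_nth F 1 = coeff a 1"
      "fps_nth F 1 * coeff b 1 + fps_nth F 2 = 0"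
      using nth[of 0] nth[of 1] nth[of 2] b0 coeff_eq_0[of a 2] coeff_eq_0[of b 2] a b
      by (simp_all add: fps_mult_nth numeral_2_eq_2)
    have split: "(\<forall>k\<le>1 + 1. P k) \<longleftrightarrow> P 0 \<and> P 1 \<and> P 2" for P :: "nat \<Rightarrow> bool"
      by (auto simp: le_Suc_eq numeral_2_eq_2)
    have "(\<forall>k\<le>1 + 1. (deriv ^^ k) (\<lambda>s. poly a s / poly b s) 0 = (deriv ^^ k) ?f 0)
        \<longleftrightarrow> (\<forall>k\<le>1 + 1. fps_nth F k = fps_nth (fps_exp (- 1)) k)"
      by (simp only: f fps_nth_has_fps_expansion[OF F]) (simp add: field_simps)
    also have "\<dots> \<longleftrightarrow> fps_nth F 0 = 1 \<and> fps_nth F 1 = - 1 \<and> fps_nth F 2 = 1 / 2"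
      unfolding split by (simp add: numeral_2_eq_2)
    \<comment> \<open>With F = 1 - s + s^2/2 + ..., the third equation gives b_1 = 1/2, and then the
      second gives a_1 = b_1 - 1 = - 1/2.\<close>
    also have "\<dots> \<longleftrightarrow> coeff a 0 = 1 \<and> coeff a 1 = - (1 / 2) \<and> coeff b 1 = 1 / 2" (is "?L \<longleftrightarrow> ?R")
    proof
      show ?R if ?L using that sys by simp
    next
      assume ?R
      \<comment> \<open>Once this value is known, the third equation is linear in the remaining
        unknown \<open>fps_nth F 2\<close>.\<close>
      moreover from this have "fps_nth F 1 = - 1" using sys by simp
      ultimately show ?L using sys by simp
    qed
    also have "\<dots> \<longleftrightarrow> a = [:1, - (1 / 2):] \<and> b = [:1, 1 / 2:]"
    proof -
      have "p = [:coeff p 0, coeff p 1:]" if "degree p \<le> 1" for p :: "real poly"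
        using that by (auto intro!: poly_eqI simp: coeff_pCons coeff_eq_0 split: nat.split)
      from this[OF a] this[OF b] show ?thesis
        using b0 by (metis coeff_pCons_0 coeff_pCons_Suc One_nat_def)
    qed
    finally show ?thesis .
  qed
  have coprime: "coprime [:1, - (1 / 2):] [:1, 1 / 2 :: real:]"
  proof (rule coprimeI)
    fix c :: "real poly"
    assume "c dvd [:1, - (1 / 2):]" "c dvd [:1, 1 / 2:]"
    \<comment> \<open>The linear terms cancel: the sum is the constant 2, a unit.\<close>
    then have "c dvd [:1, - (1 / 2):] + [:1, 1 / 2:]"
      by (rule dvd_add)
    then show "is_unit c"
      by (auto simp: dvd_trans is_unit_pCons_iff)
  qed
  have R: "(\<lambda>s. (1 - s / 2) / (1 + s / 2))
      = (\<lambda>s. poly [:1, - (1 / 2):] s / poly [:1, 1 / 2 :: real:] s)"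
    by (simp add: fun_eq_iff)
  show ?thesis
  proof
    assume "is_pade 1 1 ?f R"
    then obtain a b :: "real poly" where "degree a \<le> 1" "degree b \<le> 1" "coeff b 0 = 1"
      and R_eq: "R = (\<lambda>s. poly a s / poly b s)"
      and "\<forall>k\<le>1 + 1. (deriv ^^ k) R 0 = (deriv ^^ k) ?f 0"
      unfolding is_pade_def by blast
    then have "a = [:1, - (1 / 2):] \<and> b = [:1, 1 / 2:]"
      using agree by blast
    then show "R = (\<lambda>s. (1 - s / 2) / (1 + s / 2))"
      unfolding R R_eq by blast
  next
    assume "R = (\<lambda>s. (1 - s / 2) / (1 + s / 2))"
    moreover have "degree [:1, - (1 / 2) :: real:] \<le> 1" "degree [:1, 1 / 2 :: real:] \<le> 1"
      "coeff [:1, 1 / 2 :: real:] 0 = 1"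
      by simp_all
    ultimately show "is_pade 1 1 ?f R"
      unfolding R is_pade_def using coprime agree by blast
  qed
qed

lemma pade_1_1_exp_neg: "pade 1 1 (\<lambda>s. exp (- s)) = (\<lambda>s. (1 - s / 2) / (1 + s / 2))"
  unfolding pade_def is_pade_1_1_exp_neg_iff by simp

lemma fps_inverse_one_minus_X_square:
  "inverse (1 - fps_const y * fps_X ^ 2) = Abs_fps (\<lambda>k. if even k then (y::'a::field) ^ (k div 2) else 0)"
    (is "_ = ?G")
proof -
  \<comment> \<open>Multiplication by y t^2 moves each coefficient of the geometric series to the
    one two places later, so only the constant term 1 survives.\<close>
  have "?G - fps_const y * (fps_X ^ 2 * ?G) = 1"
  proof (rule fps_ext)
    fix k
    show "fps_nth (?G - fps_const y * (fps_X ^ 2 * ?G)) k = fps_nth 1 k"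
    proof (cases "k < 2")
      case True
      then have "k = 0 \<or> k = 1" by auto
      then show ?thesis by (auto simp: fps_X_power_mult_nth)
    next
      case False
      then obtain m where "k = m + 2" by (metis add.commute le_Suc_ex not_less)
      then show ?thesis by (simp add: fps_X_power_mult_nth)
    qed
  qed
  then have "(1 - fps_const y * fps_X ^ 2) * ?G = 1"
    by (simp add: algebra_simps)
  then show ?thesis
    by (simp add: fps_inverse_unique mult.commute)
qed

lemma trunc_exp2_eq_fps_nth:
  "trunc_exp2 n x y = fact n * fps_nth (inverse (1 - fps_const y * fps_X ^ 2) * fps_exp x) n"
proof -
  have "fps_nth (inverse (1 - fps_const y * fps_X ^ 2) * fps_exp x) n
      = (\<Sum>k\<le>n. if even k then y ^ (k div 2) * (x ^ (n - k) / fact (n - k)) else 0)"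
    unfolding fps_inverse_one_minus_X_square fps_mult_nth atLeast0AtMost
    by (intro sum.cong) auto
  also have "\<dots> = (\<Sum>k | k \<le> n \<and> even k. y ^ (k div 2) * (x ^ (n - k) / fact (n - k)))"
    by (rule sum.inter_filter[symmetric, of "{..n}", simplified])
  \<comment> \<open>Substitution k = 2 r.\<close>
  also have "\<dots> = (\<Sum>r\<le>n div 2. x ^ (n - 2 * r) * y ^ r / fact (n - 2 * r))"
    by (rule sum.reindex_bij_witness[of _ "\<lambda>r. 2 * r" "\<lambda>k. k div 2"]) auto
  finally show ?thesis
    by (simp add: trunc_exp2_def)
qed

theorem theorem1:
  fixes n :: nat
  shows "pade_He 1 1 n = deriv_op (\<lambda>d. (1 - 1/4 * d ^ 2) / (1 + 1/4 * d ^ 2)) (monom 1 n) \<and>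
    (\<forall>x. poly (deriv_op (\<lambda>d. (1 - 1/4 * d ^ 2) / (1 + 1/4 * d ^ 2)) (monom 1 n)) x
         = trunc_exp2 n x (- 1/4) - real n * (real n - 1) / 4 * trunc_exp2 (n - 2) x (- 1/4))"
proof -
  let ?A = "\<lambda>d::real. (1 - 1/4 * d ^ 2) / (1 + 1/4 * d ^ 2)"
  \<comment> \<open>The denominator 1 + t^2/4 is 1 - y t^2 at y = - 1/4, so \<open>G\<close> is the
    amplitude of the truncated exponential polynomials there.\<close>
  define G where "G = inverse (1 - fps_const (- 1 / 4 :: real) * fps_X ^ 2)"
  have "?A has_fps_expansion (1 - fps_const (1/4) * fps_X ^ 2) / (1 + fps_const (1/4) * fps_X ^ 2)"
    by (intro has_fps_expansion_divide' has_fps_expansion_add has_fps_expansion_diff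
        has_fps_expansion_cmult_left has_fps_expansion_fps_X_power has_fps_expansion_1) simp
  also have "(1 - fps_const (1/4) * fps_X ^ 2) / (1 + fps_const (1/4) * fps_X ^ 2)
      = (1 - fps_const (1/4) * fps_X ^ 2) * G"
    by (simp add: G_def fps_divide_unit fps_const_neg[symmetric] del: fps_const_neg)
  finally have A: "?A has_fps_expansion (1 - fps_const (1/4) * fps_X ^ 2) * G" .
  \<comment> \<open>Putting s = t^2/2 turns s/2 into t^2/4.\<close>
  have "pade_He 1 1 n = appell ?A n"
    unfolding pade_He_def pade_1_1_exp_neg by simp
  then have "pade_He 1 1 n = deriv_op ?A (monom 1 n)"
    by (simp only: appell_eq_deriv_op[OF A])
  moreover have "poly (deriv_op ?A (monom 1 n)) x
      = trunc_exp2 n x (- 1/4) - real n * (real n - 1) / 4 * trunc_exp2 (n - 2) x (- 1/4)" for x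
  proof -
    have "poly (deriv_op ?A (monom 1 n)) x
        = fact n * fps_nth (G * fps_exp x - fps_const (1/4) * (fps_X ^ 2 * (G * fps_exp x))) n"
      unfolding deriv_op_monom[OF A] by (simp add: algebra_simps)
    also have "\<dots> = fact n * fps_nth (G * fps_exp x) n
        - (if n < 2 then 0 else fact n / 4 * fps_nth (G * fps_exp x) (n - 2))"
      by (simp add: fps_X_power_mult_nth right_diff_distrib)
    also have "\<dots> = trunc_exp2 n x (- 1/4) - real n * (real n - 1) / 4 * trunc_exp2 (n - 2) x (- 1/4)"
    \<comment> \<open>For n < 2 the natural number \<open>n - 2\<close> is 0 and
      \<open>trunc_exp2\<close> is taken at index 0, but the factor n (n - 1) kills that term.
      Otherwise n! = n (n - 1) (n - 2)!.\<close>
    proof (cases "n < 2")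
      case True
      then have "n = 0 \<or> n = 1" by auto
      then show ?thesis using True by (auto simp: trunc_exp2_eq_fps_nth G_def)
    next
      case False
      then obtain m where "n = m + 2" by (metis add.commute le_Suc_ex not_less)
      then show ?thesis by (simp add: trunc_exp2_eq_fps_nth G_def algebra_simps)
    qed
    finally show ?thesis .
  qed
  ultimately show ?thesis by blast
qed

end
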